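(* Let $y:\mathbb{N}\to\mathbb{R}$ be any monotone increasing function with $\frac{n}{2}<y(n)<n$ for all $n\in\mathbb{N}$, and let $\mathcal{F}_y$ be the set of $y$-smooth positive integers. Then $\mathcal{F}_y$ is not totally a-primitive. In particular, $$\mathcal{F}_y\cap[9,+\infty)=\mathcal{A}+\mathcal{B},$$ where $\mathcal{A}=\{n\in\mathbb{N}:\ \text{none of } n,\,n+1,\,n+3,\,n+5 \text{ is prime}\}$ and $\mathcal{B}=\{0,1,3,5\}$.
   Context: $\mathbb{N}$ denotes the positive integers and $\mathbb{N}_0=\mathbb{N}\cup\{0\}$. For $n\in\mathbb{N}$, $p^+(n)$ denotes the greatest prime factor of $n$. For a monotone increasing positive function $y$ on $\mathbb{N}$, a positive integer $n$ is called $y$-smooth if $p^+(n)\le y(n)$, and $\mathcal{F}_y$ is the set of all $y$-smooth positive integers. For sets $\mathcal{B},\mathcal{C}$ of integers, $\mathcal{B}+\mathcal{C}=\{b+c:b\in\mathcal{B},c\in\mathcal{C}\}$. A set $\mathcal{A}\subset\mathbb{N}_0$ is a-reducible if $\mathcal{A}=\mathcal{B}+\mathcal{C}$ for some $\mathcal{B},\mathcal{C}\subset\mathbb{N}_0$ with $|\mathcal{B}|\ge2$, $|\mathcal{C}|\ge2$; otherwise it is a-primitive. Two sets $\mathcal{A},\mathcal{A}'$ of non-negative integers are asymptotically equal, written $\mathcal{A}\sim\mathcal{A}'$, if there is $K$ with $\mathcal{A}\cap[K,+\infty)=\mathcal{A}'\cap[K,+\infty)$. An infinite set $\mathcal{A}\subset\mathbb{N}_0$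 is totally a-primitive if every $\mathcal{A}'\subset\mathbb{N}_0$ with $\mathcal{A}'\sim\mathcal{A}$ is a-primitive. *)

theory Defs
  imports Complex_Main "HOL-Computational_Algebra.Primes" "HOL-Library.Set_Algebras"
begin

text \<open>
  Sets of non-negative integers are rendered as \<^typ>\<open>nat set\<close>; the sumset is the library's
  pointwise sum of sets. The convention for the greatest prime factor of 1 is the usual one
  (the value 1); the value at 0 is irrelevant.
\<close>

definition greatest_prime_factor :: "nat \<Rightarrow> nat" where
  "greatest_prime_factor n = (if n \<le> 1 then 1 else Max (prime_factors n))"

definition smooth_numbers :: "(nat \<Rightarrow> real) \<Rightarrow> nat set" where
  "smooth_numbers y = {n. 1 \<le> n \<and> real (greatest_prime_factor n) \<le> y n}"

(* card is 0 on infinite sets, so "at least two elements" has to allow them explicitly *)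
definition a_reducible :: "nat set \<Rightarrow> bool" where
  "a_reducible A \<longleftrightarrow>
     (\<exists>B C. (infinite B \<or> 2 \<le> card B) \<and> (infinite C \<or> 2 \<le> card C) \<and> A = B + C)"

definition a_primitive :: "nat set \<Rightarrow> bool" where
  "a_primitive A \<longleftrightarrow> \<not> a_reducible A"

definition asymptotically_equal :: "nat set \<Rightarrow> nat set \<Rightarrow> bool" where
  "asymptotically_equal A A' \<longleftrightarrow> (\<exists>K. A \<inter> {K..} = A' \<inter> {K..})"

definition totally_a_primitive :: "nat set \<Rightarrow> bool" where
  "totally_a_primitive A \<longleftrightarrow>
     infinite A \<and> (\<forall>A'. asymptotically_equal A' A \<longrightarrow> a_primitive A')"

end

theory Submission
  imports Defs
begin

text \<open>
  Since \<open>n/2 < y(n) < n\<close>, the smooth numbers are exactly the composite numbers. An odd composite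
  \<open>m \<ge> 9\<close> lies in \<open>\<A> + 0\<close>, because \<open>m + 1\<close>, \<open>m + 3\<close>, \<open>m + 5\<close> are even. For an even \<open>m \<ge> 10\<close>,
  one of \<open>m - 1\<close>, \<open>m - 3\<close>, \<open>m - 5\<close> is a proper multiple of 3, hence an odd composite, and so
  an element of \<open>\<A>\<close>.
\<close>

lemma not_prime_even_nat:
  fixes n :: nat
  assumes "even n" "n \<noteq> 2"
  shows "\<not> prime n"
  using assms primes_dvd_imp_eq two_is_prime_nat by blast

lemma not_prime_mult_3_nat:
  fixes n :: nat
  assumes "3 dvd n" "n \<noteq> 3"
  shows "\<not> prime n"
  using assms primes_dvd_imp_eq[of 3 n] by (auto simp: prime_nat_numeral_eq)

lemma greatest_prime_factor_prime:
  assumes "prime p"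
  shows "greatest_prime_factor p = p"
  using prime_gt_1_nat[OF assms] assms
  by (simp add: greatest_prime_factor_def prime_factorization_prime)

text \<open>The cofactor of the greatest prime factor is at least 2, since cofactor 1 would make
  \<open>n\<close> prime. The bound n/2 is the one that the lower bound on \<open>y\<close>
  exceeds.\<close>

lemma greatest_prime_factor_composite_le:
  assumes "2 \<le> n" "\<not> prime n"
  shows "2 * greatest_prime_factor n \<le> n"
proof -
  have "prime_factors n \<noteq> {}"
    using assms(1) by (auto simp: prime_factorization_empty_iff)
  then have "Max (prime_factors n) \<in> prime_factors n"
    by (intro Max_in) auto
  then have p: "prime (greatest_prime_factor n)" "greatest_prime_factor n dvd n"
    using assms(1) by (auto simp: greatest_prime_factor_def in_prime_factors_iff)
  from p(2) obtain k where k: "n = greatest_prime_factor n * k" ..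
  with p(1) assms have "k \<noteq> 0" "k \<noteq> 1"
    by (metis mult_0_right not_numeral_le_zero, metis mult_1_right)
  then have "2 \<le> k" by linarith
  then have "greatest_prime_factor n * 2 \<le> greatest_prime_factor n * k"
    by (rule mult_le_mono2)
  with k show ?thesis by simp
qed

text \<open>The upper bound on \<open>y\<close> excludes primes, which are their own greatest prime
  factor; the lower bound admits every composite.\<close>

lemma smooth_numbers_eq_composites:
  assumes "\<And>n. 1 \<le> n \<Longrightarrow> real n / 2 < y n \<and> y n < real n"
  shows "smooth_numbers y = {n. 2 \<le> n \<and> \<not> prime n}"
proof (intro set_eqI iffI)
  fix n :: nat assume n: "n \<in> smooth_numbers y"
  then have "real (greatest_prime_factor n) < real n"
    using assms[of n] by (simp add: smooth_numbers_def)
  \<comment> \<open>By convention 1 has greatest prime factor 1, which exceeds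
    \<open>y 1\<close>.\<close>
  moreover from this have "n \<noteq> 1"
    by (auto simp: greatest_prime_factor_def)
  ultimately show "n \<in> {n. 2 \<le> n \<and> \<not> prime n}"
    using n greatest_prime_factor_prime by (auto simp: smooth_numbers_def)
next
  fix n :: nat assume "n \<in> {n. 2 \<le> n \<and> \<not> prime n}"
  then have "2 \<le> n" "2 * greatest_prime_factor n \<le> n"
    using greatest_prime_factor_composite_le by auto
  then show "n \<in> smooth_numbers y"
    using assms[of n] by (simp add: smooth_numbers_def)
qed

text \<open>This is the largest set whose sum with \<open>{0, 1, 3, 5}\<close> contains only
  composites.\<close>

definition summand :: "nat set" where
  "summand = {n. 1 \<le> n \<and> \<not> prime n \<and> \<not> prime (n + 1) \<and> \<not> prime (n + 3) \<and> \<not> prime (n + 5)}"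

lemma odd_composite_in_summand:
  assumes "odd n" "2 \<le> n" "\<not> prime n"
  shows "n \<in> summand"
  using assms not_prime_even_nat[of "n + 1"] not_prime_even_nat[of "n + 3"]
    not_prime_even_nat[of "n + 5"] by (simp add: summand_def)

lemma summand_ge_9:
  assumes "n \<in> summand"
  shows "9 \<le> n"
proof (rule ccontr)
  assume "\<not> 9 \<le> n"
  \<comment> \<open>Each smaller candidate has a prime among its four shifts: 1+1, 2, 3, 4+1, 5,
    6+1, 7, 8+3.\<close>
  moreover have "prime (2::nat)" "prime (3::nat)" "prime (5::nat)" "prime (7::nat)" "prime (11::nat)"
    by (simp_all add: prime_nat_numeral_eq)
  moreover from \<open>\<not> 9 \<le> n\<close> assms have "n \<in> {1, 2, 3, 4, 5, 6, 7, 8}"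
    by (auto simp: summand_def)
  ultimately show False
    using assms by (auto simp: summand_def numeral_2_eq_2)
qed

lemma composites_ge_9_eq_sumset:
  "{n::nat. 2 \<le> n \<and> \<not> prime n} \<inter> {9..} = summand + {0, 1, 3, 5}"
proof (intro subset_antisym subsetI)
  fix m :: nat assume "m \<in> {n. 2 \<le> n \<and> \<not> prime n} \<inter> {9..}"
  then have m: "9 \<le> m" "\<not> prime m" by auto
  have "\<exists>b\<in>{0, 1, 3, 5}. b \<le> m \<and> m - b \<in> summand"
  proof (cases "even m")
    case False
    with m show ?thesis by (simp add: odd_composite_in_summand)
  next
    case True
    with m(1) have "10 \<le> m" by (cases "m = 9") auto
    \<comment> \<open>The shifts 1, 3, 5 represent all residues modulo 3.\<close>
    have "3 dvd m - 1 \<or> 3 dvd m - 3 \<or> 3 dvd m - 5"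
      using \<open>10 \<le> m\<close> by presburger
    then obtain b where b: "b \<in> {1, 3, 5}" "3 dvd m - b" by blast
    \<comment> \<open>Here m - b is odd and at least 5, so it is a multiple of 3 other than
      3.\<close>
    have "m - b \<in> summand"
      using b \<open>10 \<le> m\<close> True by (intro odd_composite_in_summand not_prime_mult_3_nat) auto
    with b(1) \<open>10 \<le> m\<close> show ?thesis by fastforce
  qed
  then obtain b where "b \<in> {0, 1, 3, 5}" "b \<le> m" "m - b \<in> summand" by blast
  then show "m \<in> summand + {0, 1, 3, 5}"
    using set_plus_intro[of "m - b" summand b "{0, 1, 3, 5}"] by simp
next
  fix m :: nat assume "m \<in> summand + {0, 1, 3, 5}"
  then obtain n b where nb: "m = n + b" "n \<in> summand" "b \<in> {0, 1, 3, 5}"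
    by (rule set_plus_elim)
  then have "9 \<le> m" using summand_ge_9[of n] by simp
  moreover from nb have "\<not> prime m" by (auto simp: summand_def)
  ultimately show "m \<in> {n. 2 \<le> n \<and> \<not> prime n} \<inter> {9..}" by simp
qed

text \<open>This is the size condition in \<open>a_reducible\<close>; 9 and 15 are odd proper
  multiples of 3, and they bound the cardinality if \<open>summand\<close> is finite.\<close>

lemma summand_at_least_two: "infinite summand \<or> 2 \<le> card summand"
proof -
  have "{9, 15} \<subseteq> summand"
    by (auto intro!: odd_composite_in_summand not_prime_mult_3_nat)
  then show ?thesis
    using card_mono[of summand "{9, 15}"] by auto
qed

theorem theorem1:
  fixes y :: "nat \<Rightarrow> real"
  assumes "mono_on {1..} y"
    and "\<And>n. 1 \<le> n \<Longrightarrow> real n / 2 < y n \<and> y n < real n"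
  shows "\<not> totally_a_primitive (smooth_numbers y) \<and>
    smooth_numbers y \<inter> {9..} =
      {n. 1 \<le> n \<and> \<not> prime n \<and> \<not> prime (n + 1) \<and> \<not> prime (n + 3) \<and> \<not> prime (n + 5)}
      + {0, 1, 3, 5}"
proof -
  have eq: "smooth_numbers y \<inter> {9..} = summand + {0, 1, 3, 5}"
    using smooth_numbers_eq_composites[OF assms(2)] composites_ge_9_eq_sumset by simp
  have "2 \<le> card {0, 1, 3, 5::nat}" by simp
  \<comment> \<open>The truncation at 9 is the asymptotically equal set that refutes total
    a-primitivity.\<close>
  then have "a_reducible (smooth_numbers y \<inter> {9..})"
    unfolding a_reducible_def using eq summand_at_least_two by blast
  moreover have "asymptotically_equal (smooth_numbers y \<inter> {9..}) (smooth_numbers y)"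
    unfolding asymptotically_equal_def by (rule exI[of _ 9]) auto
  ultimately have "\<not> totally_a_primitive (smooth_numbers y)"
    unfolding totally_a_primitive_def a_primitive_def by blast
  with eq show ?thesis unfolding summand_def by blast
qed

end
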